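(* Fix $\mu>0$ satisfying the standing non-degeneracy condition stated in the context, $L\ge 1$, $0<\varepsilon\leq 1$ and $0<\delta<\mu$. Let $\omega_{\mu,L,\varepsilon}(u)$ be the infinitely divisible field defined in the context. Let $X(\delta)$ be the value at time $\delta$ of a Lévy process, independent of the process $u\mapsto\omega_{\mu,L,\varepsilon}(u)$, with $X(0)=0$ and $\mathbf{E}[e^{iqX(\delta)}]=e^{\delta\phi(q)}$ for $q\in\mathbb{R}$. Let $\omega_{\mu-\delta,L,\varepsilon}(u)$ be the field of the same construction with intermittency $\mu-\delta$ and parameter $L$. Let $\bar\omega_{\delta,eL,\varepsilon}(u)$ be a field of the same construction with intermittency $\delta$ and parameter $eL$ ($e$ being the base of the natural logarithm), independent of $\omega_{\mu-\delta,L,\varepsilon}$. Then there is the equality in law of stochastic processes in $u$ on the interval $u\in[0,1]$: $$X(\delta)+\omega_{\mu,L,\varepsilon}(u)=\omega_{\mu-\delta,L,\varepsilon}(u)+\bar\omega_{\delta,eL,\varepsilon}(u).$$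
   Context: **Infinitely divisible exponent.** Let $\sigma^2\ge 0$ and let $\mathcal{M}$ be a Lévy spectral function: continuous and non-decreasing on $(-\infty,0)$ and on $(0,\infty)$, with $\int_{[-1,1]\setminus\{0\}}u^2\,d\mathcal{M}(u)<\infty$ and $\lim_{u\to\pm\infty}\mathcal{M}(u)=0$. It is assumed that $\mathcal{M}$ decays fast enough at infinity that all integrals with respect to $d\mathcal{M}$ that are used converge. (The pure point mass case $d\mathcal{M}(u)=\delta(u-\log c)\,du$, $c>0$, $c\ne1$, is also allowed.) Put $$\phi(q)=-\frac{iq\sigma^2}{2}-\frac{q^2\sigma^2}{2}+\int_{\mathbb{R}\setminus\{0\}}\bigl(e^{iqu}-1-iq(e^u-1)\bigr)\,d\mathcal{M}(u),$$ so that $\phi(-i)=0$. **Intensity measure.** Let $r$ be positive, smooth and even on $(-1,0)\cup(0,1)$ (with the one-sided values of $r$ and $r'$ at $1$ existing and $r(1)=1$), with $\lim_{t\to0^+}t\frac{d}{dt}\log r(t)=1$. Define $f(l)=-l^2\frac{d^2}{dl^2}\log r(l)$ for $l\in(0,1)$ and $f(l)=\frac{d}{dz}\big|_{z=1}\log r(z)$ for $l\ge1$, and assume $f>0$. (The Bacry–Muzy case is $r(t)=|t|$, $f=1$.) Let $\rho(dt\,dl)=\frac{f(l)}{l^2}\,dt\,dl$ on $\mathbb{H}_+=\{(t,l):l>0\}$. **The field.** For $\mu>0$ let $P$ be an infinitely divisible independently scattered random measure on $\mathbb{H}_+$: $P(A)$ and $P(B)$ are independent for disjoint $A,B$, and $\mathbf{E}[e^{iqP(A)}]=e^{\mu\phi(q)\rho(A)}$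 for $q\in\mathbb{R}$. For $0<\varepsilon\le1$ let $$\mathcal{A}_\varepsilon(u)=\Bigl\{(t,l): |t-u|\le \tfrac{l}{2}\text{ for }\varepsilon\le l\le 1,\ \ |t-u|\le\tfrac12\text{ for }l\ge1\Bigr\},$$ and $\omega_{\mu,\varepsilon}(u)=P(\mathcal{A}_\varepsilon(u))$. The parameter $\mu$ is called the intermittency. One has $\rho(\mathcal{A}_\varepsilon(u)\cap\mathcal{A}_\varepsilon(v))=\rho_\varepsilon(u-v)$, where $\rho_\varepsilon(u)=-\log r(u)$ if $\varepsilon\le|u|\le1$, $\rho_\varepsilon(u)=-\log r(\varepsilon)+\bigl(1-\frac{|u|}{\varepsilon}\bigr)\varepsilon\frac{d}{d\varepsilon}\log r(\varepsilon)$ if $|u|<\varepsilon$, and $\rho_\varepsilon(u)=0$ if $|u|>1$. **The extended field.** For $L\ge1$ let $Z_L$ be a random variable independent of the process $\omega_{\mu,\varepsilon}$ with $\mathbf{E}[e^{iqZ_L}]=e^{\mu\phi(q)\log L}$, and set $\omega_{\mu,L,\varepsilon}(u)=\omega_{\mu,\varepsilon}(u)+Z_L$. (Thus for intermittency $\mu'$ in place of $\mu$, both $P$ and $Z_L$ are taken with $\mu'$.) **Standing assumption (non-degeneracy).** $1-\mu\Bigl(\frac{\sigma^2}{2}+\int_{\mathbb{R}\setminus\{0\}}(ue^u-e^u+1)\,d\mathcal{M}(u)\Bigr)>0$. *)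

theory Defs
  imports "HOL-Probability.Probability"
begin

definition levy_spectral_function :: "(real \<Rightarrow> real) \<Rightarrow> bool" where
  "levy_spectral_function F \<longleftrightarrow>
     continuous_on {..<0} F \<and> mono_on {..<0} F \<and>
     continuous_on {0<..} F \<and> mono_on {0<..} F \<and>
     (F \<longlongrightarrow> 0) at_bot \<and> (F \<longlongrightarrow> 0) at_top"

(* \<nu> is the Lebesgue-Stieltjes measure dF on \<real> - {0}, viewed as a Borel measure on \<real> without mass at 0.
   The half-open intervals whose closure avoids 0 generate the Borel sets of \<real> - {0}, so F determines \<nu>. *)
definition is_stieltjes_measure :: "(real \<Rightarrow> real) \<Rightarrow> real measure \<Rightarrow> bool" where
  "is_stieltjes_measure F \<nu> \<longleftrightarrow>
     sets \<nu> = sets borel \<and> emeasure \<nu> {0} = 0 \<and>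
     (\<forall>a b. a \<le> b \<and> (b < 0 \<or> 0 < a) \<longrightarrow> emeasure \<nu> {a<..b} = ennreal (F b - F a))"

(* The measures dM allowed in the exponent: those of a continuous Levy spectral function, and the unit
   point mass at log c.  The last two conjuncts say that M decays fast enough for the integrals defining
   \<phi>(q), q real, and the non-degeneracy constant to converge. *)
definition spectral_measure :: "real measure \<Rightarrow> bool" where
  "spectral_measure \<nu> \<longleftrightarrow>
     ((\<exists>F. levy_spectral_function F \<and> is_stieltjes_measure F \<nu> \<and>
           set_integrable \<nu> ({-1..1} - {0}) (\<lambda>u. u\<^sup>2)) \<or>
      (\<exists>c. 0 < c \<and> c \<noteq> 1 \<and> \<nu> = return borel (ln c))) \<and>
     (\<forall>q::real. set_integrable \<nu> (- {0})
        (\<lambda>u. exp (\<i> * of_real q * of_real u) - 1 - \<i> * of_real q * of_real (exp u - 1))) \<and>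
     set_integrable \<nu> (- {0}) (\<lambda>u. u * exp u - exp u + 1)"

definition id_exponent :: "real \<Rightarrow> real measure \<Rightarrow> complex \<Rightarrow> complex" where
  "id_exponent \<sigma> \<nu> q =
     - (\<i> * q * of_real (\<sigma>\<^sup>2)) / 2 - q\<^sup>2 * of_real (\<sigma>\<^sup>2) / 2 +
     (CLINT u : - {0} | \<nu>. exp (\<i> * q * of_real u) - 1 - \<i> * q * of_real (exp u - 1))"

lemma id_exponent_minus_i: "id_exponent \<sigma> \<nu> (- \<i>) = 0"
  by (simp add: id_exponent_def exp_of_real)

definition nondegenerate :: "real \<Rightarrow> real measure \<Rightarrow> real \<Rightarrow> bool" where
  "nondegenerate \<sigma> \<nu> \<mu> \<longleftrightarrow>
     1 - \<mu> * (\<sigma>\<^sup>2 / 2 + (LINT u : - {0} | \<nu>. u * exp u - exp u + 1)) > 0"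

(* The derivative at z = 1 is one-sided, since r is only differentiable on (-1,0) \<union> (0,1). *)
definition cone_density :: "(real \<Rightarrow> real) \<Rightarrow> real \<Rightarrow> real" where
  "cone_density r l =
     (if l < 1 then - (l\<^sup>2) * (deriv ^^ 2) (\<lambda>t. ln (r t)) l
      else vector_derivative (\<lambda>z. ln (r z)) (at_left 1))"

(* The left derivative d of r at 1 also encodes the left continuity of r there, hence r(1-) = r(1) = 1. *)
definition admissible_kernel :: "(real \<Rightarrow> real) \<Rightarrow> bool" where
  "admissible_kernel r \<longleftrightarrow>
     (\<forall>t. 0 < \<bar>t\<bar> \<and> \<bar>t\<bar> < 1 \<longrightarrow> 0 < r t \<and> r (- t) = r t \<and> (\<forall>n. (deriv ^^ n) r differentiable (at t))) \<and>
     r 1 = 1 \<and>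
     (\<exists>d. (r has_real_derivative d) (at_left 1) \<and> (deriv r \<longlongrightarrow> d) (at_left 1)) \<and>
     ((\<lambda>t. t * deriv (\<lambda>s. ln (r s)) t) \<longlongrightarrow> 1) (at_right 0) \<and>
     (\<forall>l>0. 0 < cone_density r l)"

definition half_plane :: "(real \<times> real) set" where
  "half_plane = {(t, l). 0 < l}"

definition intensity :: "(real \<Rightarrow> real) \<Rightarrow> (real \<times> real) measure" where
  "intensity r = density (restrict_space lborel half_plane) (\<lambda>(t, l). ennreal (cone_density r l / l\<^sup>2))"

definition cone :: "real \<Rightarrow> real \<Rightarrow> (real \<times> real) set" where
  "cone \<epsilon> u = {(t, l). (\<epsilon> \<le> l \<and> l \<le> 1 \<and> \<bar>t - u\<bar> \<le> l / 2) \<or> (1 \<le> l \<and> \<bar>t - u\<bar> \<le> 1 / 2)}"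

(* indep_var of the library requires both variables to take values in the same type. *)
definition independent_rvs ::
  "'w measure \<Rightarrow> 'x measure \<Rightarrow> ('w \<Rightarrow> 'x) \<Rightarrow> 'y measure \<Rightarrow> ('w \<Rightarrow> 'y) \<Rightarrow> bool" where
  "independent_rvs \<Omega> A X B Y \<longleftrightarrow>
     X \<in> measurable \<Omega> A \<and> Y \<in> measurable \<Omega> B \<and>
     prob_space.indep_set \<Omega> {X -` S \<inter> space \<Omega> |S. S \<in> sets A} {Y -` S \<inter> space \<Omega> |S. S \<in> sets B}"

abbreviation path_space :: "real set \<Rightarrow> (real \<Rightarrow> real) measure" where
  "path_space I \<equiv> (\<Pi>\<^sub>M u\<in>I. borel)"

definition process_law :: "'w measure \<Rightarrow> real set \<Rightarrow> (real \<Rightarrow> 'w \<Rightarrow> real) \<Rightarrow> (real \<Rightarrow> real) measure" where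
  "process_law \<Omega> I Y = distr \<Omega> (path_space I) (\<lambda>w. \<lambda>u\<in>I. Y u w)"

definition finite_sets :: "'x measure \<Rightarrow> 'x set set" where
  "finite_sets \<rho> = {A \<in> sets \<rho>. emeasure \<rho> A < \<infinity>}"

(* Independently scattered random measure, defined on the sets of finite intensity: independence over
   sequences of disjoint sets (finite families are covered by padding with the empty set) and almost sure
   countable additivity. *)
definition id_random_measure ::
  "'w measure \<Rightarrow> (complex \<Rightarrow> complex) \<Rightarrow> 'x measure \<Rightarrow> real \<Rightarrow> ('x set \<Rightarrow> 'w \<Rightarrow> real) \<Rightarrow> bool" where
  "id_random_measure \<Omega> \<phi> \<rho> \<mu> P \<longleftrightarrow>
     (\<forall>A\<in>finite_sets \<rho>. P A \<in> borel_measurable \<Omega>) \<and>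
     (\<forall>A::nat \<Rightarrow> 'x set. range A \<subseteq> finite_sets \<rho> \<and> disjoint_family A \<longrightarrow>
        prob_space.indep_vars \<Omega> (\<lambda>_. borel) (\<lambda>n. P (A n)) UNIV) \<and>
     (\<forall>A::nat \<Rightarrow> 'x set. range A \<subseteq> finite_sets \<rho> \<and> disjoint_family A \<and> (\<Union>n. A n) \<in> finite_sets \<rho> \<longrightarrow>
        (AE w in \<Omega>. (\<lambda>n. P (A n) w) sums P (\<Union>n. A n) w)) \<and>
     (\<forall>A\<in>finite_sets \<rho>. \<forall>q::real.
        (CLINT w | \<Omega>. exp (\<i> * of_real q * of_real (P A w))) =
          exp (of_real \<mu> * \<phi> (of_real q) * of_real (measure \<rho> A)))"

(* W is the field \<omega>_{\<mu>,L,\<epsilon>} built from some random measure P and some independent variable Z = Z_L. *)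
definition extended_field ::
  "'w measure \<Rightarrow> (complex \<Rightarrow> complex) \<Rightarrow> (real \<times> real) measure \<Rightarrow> real \<Rightarrow> real \<Rightarrow> real
     \<Rightarrow> (real \<Rightarrow> 'w \<Rightarrow> real) \<Rightarrow> bool" where
  "extended_field \<Omega> \<phi> \<rho> \<mu> L \<epsilon> W \<longleftrightarrow>
     (\<exists>P Z. id_random_measure \<Omega> \<phi> \<rho> \<mu> P \<and>
        independent_rvs \<Omega> borel Z (path_space UNIV) (\<lambda>w u. P (cone \<epsilon> u) w) \<and>
        (\<forall>q::real. (CLINT w | \<Omega>. exp (\<i> * of_real q * of_real (Z w))) =
           exp (of_real \<mu> * \<phi> (of_real q) * of_real (ln L))) \<and>
        W = (\<lambda>u w. P (cone \<epsilon> u) w + Z w))"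

definition levy_process :: "'w measure \<Rightarrow> (real \<Rightarrow> 'w \<Rightarrow> real) \<Rightarrow> bool" where
  "levy_process \<Omega> X \<longleftrightarrow>
     (\<forall>t\<ge>0. X t \<in> borel_measurable \<Omega>) \<and>
     (AE w in \<Omega>. X 0 w = 0) \<and>
     (\<forall>(t::nat \<Rightarrow> real) n. 0 \<le> t 0 \<and> (\<forall>i<n. t i \<le> t (Suc i)) \<longrightarrow>
        prob_space.indep_vars \<Omega> (\<lambda>_. borel) (\<lambda>i w. X (t (Suc i)) w - X (t i) w) {..<n}) \<and>
     (\<forall>s\<ge>0. \<forall>h\<ge>0. distr \<Omega> borel (\<lambda>w. X (s + h) w - X s w) = distr \<Omega> borel (X h)) \<and>
     (\<forall>s\<ge>0. \<forall>a>0. ((\<lambda>t. measure \<Omega> {w \<in> space \<Omega>. a < \<bar>X t w - X s w\<bar>}) \<longlongrightarrow> 0) (at s within {0..}))"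

end

theory Submission
  imports Defs
begin

text \<open>
  The joint characteristic function of the values of an independently scattered measure on finitely many sets
  is a product over the cells of their Venn diagram, so for the cones it is
  \<open>exp (\<mu> * \<kappa>)\<close> with \<open>\<kappa>\<close> depending on \<open>\<phi>\<close> and the intensity only. Hence the finite-dimensional
  characteristic functions of an extended field are \<open>exp (\<mu> * (\<kappa> + \<phi> s * ln L))\<close>, where \<open>s\<close> is the sum of the
  coefficients, and both sides of the theorem have the exponent
  \<open>\<mu> * (\<kappa> + \<phi> s * ln L) + \<delta> * \<phi> s\<close>: on the right the additional \<open>\<delta> * \<phi> s\<close> is the contribution of
  \<open>ln (e * L) = 1 + ln L\<close>. It remains that the joint characteristic functions determine the law, which is reduced
  to Levy's one-dimensional uniqueness theorem one coordinate at a time.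
\<close>

subsection \<open>Uniqueness of joint characteristic functions\<close>

lemma (in prob_space) integrable_bounded:
  fixes f :: "'a \<Rightarrow> 'b::{banach, second_countable_topology}"
  assumes "f \<in> borel_measurable M" "\<And>w. w \<in> space M \<Longrightarrow> norm (f w) \<le> C"
  shows "integrable M f"
  using assms by (intro integrable_const_bound[of _ C]) auto

text \<open>If the common total mass \<open>c\<close> of the weights is zero, both sides lie between
  0 and \<open>c\<close>. Otherwise \<open>g / c\<close> and \<open>h / c\<close> are probability
  densities, the laws of \<open>X\<close> and \<open>Y\<close> under them have equal characteristic
  functions, and Levy's uniqueness theorem identifies these laws.\<close>

lemma weighted_char_eq_imp:
  fixes X g :: "'a \<Rightarrow> real" and Y h :: "'b \<Rightarrow> real"
  assumes M: "prob_space M" and N: "prob_space N"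
    and X[measurable]: "X \<in> borel_measurable M" and Y[measurable]: "Y \<in> borel_measurable N"
    and g[measurable]: "g \<in> borel_measurable M" and h[measurable]: "h \<in> borel_measurable N"
    and g_bd: "\<And>w. 0 \<le> g w" "\<And>w. g w \<le> C"
    and h_bd: "\<And>w. 0 \<le> h w" "\<And>w. h w \<le> C"
    and eq: "\<And>t. (CLINT w|M. of_real (g w) * iexp (t * X w)) = (CLINT w|N. of_real (h w) * iexp (t * Y w))"
    and A[measurable]: "A \<in> sets borel"
  shows "(LINT w|M. g w * indicator A (X w)) = (LINT w|N. h w * indicator A (Y w))"
proof -
  interpret M: prob_space M by fact
  interpret N: prob_space N by fact
  \<comment> \<open>At frequency 0 the assumed equation says that \<open>g\<close> and
    \<open>h\<close> have the same integral, so one constant normalises both.\<close>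
  define c where "c = (LINT w|M. g w)"
  have "complex_of_real (LINT w|M. g w) = of_real (LINT w|N. h w)"
    using eq[of 0] by simp
  then have c: "c = (LINT w|N. h w)"
    unfolding c_def by (simp only: of_real_eq_iff)
  have int: "integrable M g" "integrable N h"
    using g_bd h_bd by (auto intro!: M.integrable_bounded[of _ C] N.integrable_bounded[of _ C])
  have intA: "integrable M (\<lambda>w. g w * indicator A (X w))" "integrable N (\<lambda>w. h w * indicator A (Y w))"
    using g_bd h_bd order_trans[OF g_bd] order_trans[OF h_bd]
    by (auto intro!: M.integrable_bounded[of _ C] N.integrable_bounded[of _ C] simp: indicator_def)
  have "c \<ge> 0"
    unfolding c_def using g_bd by simp
  show ?thesis
  proof (cases "c = 0")
    case True
    have "(LINT w|M. g w * indicator A (X w)) \<le> c"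
      unfolding c_def using int intA g_bd by (intro integral_mono) (auto simp: indicator_def)
    moreover have "(LINT w|N. h w * indicator A (Y w)) \<le> c"
      unfolding c using int intA h_bd by (intro integral_mono) (auto simp: indicator_def)
    moreover have "(LINT w|M. g w * indicator A (X w)) \<ge> 0" "(LINT w|N. h w * indicator A (Y w)) \<ge> 0"
      using g_bd h_bd by auto
    ultimately show ?thesis
      using True by linarith
  next
    case False
    then have "c > 0"
      using \<open>c \<ge> 0\<close> by simp
    \<comment> \<open>A generic space \<open>K\<close> allows one argument to serve both
      \<open>M\<close> and \<open>N\<close>, whose underlying types differ.\<close>
    have real_distribution: "real_distribution (distr (density K (\<lambda>w. f w / c)) borel V)"
      if "prob_space K" "V \<in> borel_measurable K" "integrable K f" "\<And>w. 0 \<le> f w" "c = (LINT w|K. f w)"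
      for K :: "'k measure" and V f
    proof -
      interpret K: prob_space K by fact
      have [measurable]: "f \<in> borel_measurable K" "V \<in> borel_measurable K"
        using that by auto
      have "emeasure (density K (\<lambda>w. f w / c)) (space K) = (\<integral>\<^sup>+w. f w / c \<partial>K)"
        by (auto simp: emeasure_density intro!: nn_integral_cong)
      also have "\<dots> = ennreal (LINT w|K. f w / c)"
        using that \<open>c > 0\<close> by (intro nn_integral_eq_integral) auto
      also have "(LINT w|K. f w / c) = 1"
        using that(5) \<open>c > 0\<close> by simp
      finally have "prob_space (density K (\<lambda>w. f w / c))"
        by (intro prob_spaceI) simp
      then show ?thesis
        by (intro prob_space.real_distribution_distr) simp_all
    qed
    define M1 where "M1 = distr (density M (\<lambda>w. g w / c)) borel X"
    define N1 where "N1 = distr (density N (\<lambda>w. h w / c)) borel Y"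
    have M1: "real_distribution M1"
      unfolding M1_def using M X int(1) g_bd(1) c_def by (rule real_distribution)
    have N1: "real_distribution N1"
      unfolding N1_def using N Y int(2) h_bd(1) c by (rule real_distribution)
    have "char M1 t = char N1 t" for t
    proof -
      have "char M1 t = (CLINT w|M. (of_real (g w) * iexp (t * X w)) / of_real c)"
        unfolding char_def M1_def using \<open>c > 0\<close> g_bd
        by (subst integral_distr) (auto simp: integral_density scaleR_conv_of_real)
      also have "\<dots> = (CLINT w|N. (of_real (h w) * iexp (t * Y w)) / of_real c)"
        using eq[of t] by simp
      also have "\<dots> = char N1 t"
        unfolding char_def N1_def using \<open>c > 0\<close> h_bd
        by (subst integral_distr) (auto simp: integral_density scaleR_conv_of_real)
      finally show ?thesis .
    qed
    then have "M1 = N1"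
      using M1 N1 by (intro Levy_uniqueness) auto
    then have "(LINT x|M1. indicator A x :: real) = (LINT x|N1. indicator A x)"
      by simp
    moreover have "(LINT x|M1. indicator A x) = (LINT w|M. g w * indicator A (X w) / c)"
      unfolding M1_def using \<open>c > 0\<close> g_bd
      by (subst integral_distr) (auto simp: integral_density)
    moreover have "(LINT x|N1. indicator A x) = (LINT w|N. h w * indicator A (Y w) / c)"
      unfolding N1_def using \<open>c > 0\<close> h_bd
      by (subst integral_distr) (auto simp: integral_density)
    ultimately show ?thesis
      using \<open>c > 0\<close> by simp
  qed
qed

text \<open>
  The induction moves one coordinate at a time from the exponent into an indicator. Levy's theorem needs
  nonnegative weights, so the factor \<open>iexp \<theta>\<close> of the remaining coordinates is recovered from the weights
  \<open>1 + cos (\<theta> - \<alpha>)\<close> with \<open>\<alpha> = 0\<close> and \<open>\<alpha> = pi / 2\<close>.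
\<close>
lemma joint_char_eq_imp_mixed:
  fixes X :: "'i \<Rightarrow> 'a \<Rightarrow> real" and Y :: "'i \<Rightarrow> 'b \<Rightarrow> real"
  assumes M: "prob_space M" and N: "prob_space N"
    and X: "\<And>i. i \<in> K \<Longrightarrow> X i \<in> borel_measurable M"
    and Y: "\<And>i. i \<in> K \<Longrightarrow> Y i \<in> borel_measurable N"
    and eq: "\<And>J q. finite J \<Longrightarrow> J \<subseteq> K \<Longrightarrow>
      (CLINT w|M. iexp (\<Sum>j\<in>J. q j * X j w)) = (CLINT w|N. iexp (\<Sum>j\<in>J. q j * Y j w))"
    and A: "\<And>i. i \<in> K \<Longrightarrow> A i \<in> sets borel"
    and "finite I" "finite J" "I \<inter> J = {}" "I \<subseteq> K" "J \<subseteq> K"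
  shows "(CLINT w|M. of_real (\<Prod>i\<in>I. indicator (A i) (X i w)) * iexp (\<Sum>j\<in>J. q j * X j w)) =
         (CLINT w|N. of_real (\<Prod>i\<in>I. indicator (A i) (Y i w)) * iexp (\<Sum>j\<in>J. q j * Y j w))"
  using assms(7-)
proof (induction I arbitrary: J q)
  case empty
  then show ?case
    using eq by simp
next
  case (insert k I)
  interpret M: prob_space M by fact
  interpret N: prob_space N by fact
  define G where "G w = (\<Prod>i\<in>I. indicator (A i) (X i w) :: real)" for w
  define H where "H w = (\<Prod>i\<in>I. indicator (A i) (Y i w) :: real)" for w
  define \<theta> where "\<theta> q w = (\<Sum>j\<in>J. q j * X j w)" for q w
  define \<eta> where "\<eta> q w = (\<Sum>j\<in>J. q j * Y j w)" for q w
  have k: "k \<in> K" "k \<notin> J" "k \<notin> I"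
    using insert by auto
  have G01: "0 \<le> G w" "G w \<le> 1" and H01: "0 \<le> H v" "H v \<le> 1" for w v
    unfolding G_def H_def by (auto intro!: prod_nonneg prod_le_1)
  have [measurable]: "G \<in> borel_measurable M" "H \<in> borel_measurable N" "X k \<in> borel_measurable M" "Y k \<in> borel_measurable N"
    "A k \<in> sets borel"
    unfolding G_def H_def using insert.prems X Y A k
    by (auto intro!: borel_measurable_prod measurable_compose[OF X] measurable_compose[OF Y] borel_measurable_indicator)
  have [measurable]: "\<theta> q \<in> borel_measurable M" "\<eta> q \<in> borel_measurable N" for q
    unfolding \<theta>_def \<eta>_def using insert.prems X Y by (auto intro!: borel_measurable_sum borel_measurable_times)
  \<comment> \<open>The coordinate \<open>k\<close> enters the exponent with a free frequency
    \<open>t\<close>; as a function of \<open>t\<close> this is a weighted characteristic function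
    of \<open>X k\<close>.\<close>
  have IH: "(CLINT w|M. of_real (G w) * iexp (\<theta> q w + t * X k w)) =
      (CLINT w|N. of_real (H w) * iexp (\<eta> q w + t * Y k w))" for q t
  proof -
    have "(\<Sum>j\<in>insert k J. (q(k := t)) j * X j w) = \<theta> q w + t * X k w"
      "(\<Sum>j\<in>insert k J. (q(k := t)) j * Y j v) = \<eta> q v + t * Y k v" for w v
      unfolding \<theta>_def \<eta>_def using k insert.prems by (auto intro!: sum.cong)
    then show ?thesis
      using insert.IH[of "insert k J" "q(k := t)"] insert.prems insert.hyps
      unfolding G_def H_def by simp
  qed
  \<comment> \<open>The weight is a product of indicators, hence at most 1, times
    \<open>1 + cos\<close>, which lies between 0 and 2.\<close>
  have cos_eq: "(LINT w|M. G w * (1 + cos (\<theta> q w - \<alpha>)) * indicator (A k) (X k w)) =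
      (LINT w|N. H w * (1 + cos (\<eta> q w - \<alpha>)) * indicator (A k) (Y k w))" for q \<alpha>
  proof (rule weighted_char_eq_imp[OF M N, where C = 2])
    fix t
    \<comment> \<open>Writing the cosine as half a sum of exponentials splits the integral into
      three instances of \<open>IH\<close>, with the frequencies 0, \<open>q\<close> and
      \<open>- q\<close> on \<open>J\<close>; the summand \<open>0 + y\<close> has the shape of the
      first of them.\<close>
    have expand: "of_real (c * (1 + cos (x - \<alpha>))) * iexp y =
        of_real c * iexp (0 + y) + (iexp (- \<alpha>) / 2 * (of_real c * iexp (x + y)) + iexp \<alpha> / 2 * (of_real c * iexp (- x + y)))"
      for c x y :: real
      by (simp add: cos_exp_eq cos_of_real[symmetric] exp_add exp_diff exp_minus algebra_simps field_simps
           del: cos_of_real flip: exp_add)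
    have neg: "\<theta> (\<lambda>j. - q j) w = - \<theta> q w" "\<eta> (\<lambda>j. - q j) v = - \<eta> q v"
         "\<theta> (\<lambda>j. 0) w = 0" "\<eta> (\<lambda>j. 0) v = 0" for w v
      by (auto simp: \<theta>_def \<eta>_def sum_negf)
    have int: "integrable M (\<lambda>w. of_real (G w) * iexp (\<theta> p w + t * X k w))"
      "integrable N (\<lambda>w. of_real (H w) * iexp (\<eta> p w + t * Y k w))" for p
      using G01 H01 by (auto intro!: M.integrable_bounded[of _ 1] N.integrable_bounded[of _ 1] simp: norm_mult)
    show "(CLINT w|M. of_real (G w * (1 + cos (\<theta> q w - \<alpha>))) * iexp (t * X k w)) =
      (CLINT w|N. of_real (H w * (1 + cos (\<eta> q w - \<alpha>))) * iexp (t * Y k w))"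
      unfolding expand
      using int[of q] int[of "\<lambda>j. - q j"] int[of "\<lambda>j. 0"]
        IH[of q t] IH[of "\<lambda>j. - q j" t] IH[of "\<lambda>j. 0" t]
      unfolding neg by simp
  next
    fix w v
    have "0 \<le> 1 + cos (\<theta> q w - \<alpha>)" "1 + cos (\<theta> q w - \<alpha>) \<le> 2"
       "0 \<le> 1 + cos (\<eta> q v - \<alpha>)" "1 + cos (\<eta> q v - \<alpha>) \<le> 2"
      using cos_ge_minus_one[of "\<theta> q w - \<alpha>"] cos_le_one[of "\<theta> q w - \<alpha>"]
       cos_ge_minus_one[of "\<eta> q v - \<alpha>"] cos_le_one[of "\<eta> q v - \<alpha>"] by linarith+
    then show "0 \<le> G w * (1 + cos (\<theta> q w - \<alpha>))" "G w * (1 + cos (\<theta> q w - \<alpha>)) \<le> 2"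
       "0 \<le> H v * (1 + cos (\<eta> q v - \<alpha>))" "H v * (1 + cos (\<eta> q v - \<alpha>)) \<le> 2"
      using G01[of w] H01[of v] mult_mono[of "G w" 1 "1 + cos (\<theta> q w - \<alpha>)" 2] 
        mult_mono[of "H v" 1 "1 + cos (\<eta> q v - \<alpha>)" 2] by auto
  qed auto
  define g where "g w = G w * indicator (A k) (X k w)" for w
  define h where "h w = H w * indicator (A k) (Y k w)" for w
  have [measurable]: "g \<in> borel_measurable M" "h \<in> borel_measurable N"
    unfolding g_def h_def by measurable
  have gh01: "\<bar>g w\<bar> \<le> 1" "\<bar>h v\<bar> \<le> 1" for w v
    using G01 H01 by (auto simp: g_def h_def indicator_def)
  have "\<bar>g w * cos x\<bar> \<le> 1" "\<bar>h v * cos x\<bar> \<le> 1" for w v x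
    unfolding abs_mult using gh01(1)[of w] gh01(2)[of v] abs_cos_le_one[of x] by (auto intro!: mult_le_one)
  then have int_cos: "integrable M (\<lambda>w. g w * cos (\<theta> q w - \<alpha>))" "integrable N (\<lambda>w. h w * cos (\<eta> q w - \<alpha>))" for q \<alpha>
    by (auto intro!: M.integrable_bounded[of _ 1] N.integrable_bounded[of _ 1])
  have int_gh: "integrable M g" "integrable N h"
    using gh01 by (auto intro!: M.integrable_bounded[of _ 1] N.integrable_bounded[of _ 1])
  have cos_eq': "(LINT w|M. g w) + (LINT w|M. g w * cos (\<theta> q w - \<alpha>)) =
      (LINT w|N. h w) + (LINT w|N. h w * cos (\<eta> q w - \<alpha>))" for q \<alpha>
  proof -
    have "G w * (1 + cos x) * indicator (A k) (X k w) = g w + g w * cos x"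
      "H v * (1 + cos x) * indicator (A k) (Y k v) = h v + h v * cos x" for w v x
      by (simp_all add: g_def h_def algebra_simps)
    then show ?thesis
      using cos_eq[of q \<alpha>] int_cos int_gh by simp
  qed
  \<comment> \<open>With zero frequencies and phase the cosine is 1 and both sides are twice the
    plain integral, so these integrals agree and cancel from \<open>cos_eq'\<close>.\<close>
  have "(LINT w|M. g w) = (LINT w|N. h w)"
    using cos_eq'[of "\<lambda>_. 0" 0] by (simp add: \<theta>_def \<eta>_def)
  with cos_eq' have cos_eq: "(LINT w|M. g w * cos (\<theta> q w - \<alpha>)) = (LINT w|N. h w * cos (\<eta> q w - \<alpha>))" for q \<alpha>
    by simp
  \<comment> \<open>Since \<open>cos (x - pi/2)\<close> is \<open>sin x\<close>, the phases 0 and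
    \<open>pi/2\<close> give the real and the imaginary part.\<close>
  have cis: "complex_of_real c * iexp x = of_real (c * cos (x - 0)) + \<i> * of_real (c * cos (x - pi/2))" for c x
    by (simp add: cis_conv_exp[symmetric] complex_eq_iff cos_sin_eq[of "x - pi/2"] cos_diff)
  have "(CLINT w|M. of_real (g w) * iexp (\<theta> q w)) = (CLINT w|N. of_real (h w) * iexp (\<eta> q w))"
    unfolding cis using int_cos[of q] cos_eq[of q]
    by (subst (1 2) Bochner_Integration.integral_add)
       (simp_all only: integral_mult_right_zero integral_complex_of_real integrable_mult_right integrable_of_real)
  then show ?case
    using insert.hyps by (simp add: g_def h_def G_def H_def \<theta>_def \<eta>_def mult_ac)
qed

lemma measurable_process:
  assumes "\<And>u. u \<in> I \<Longrightarrow> Y u \<in> borel_measurable M"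
  shows "(\<lambda>w. \<lambda>u\<in>I. Y u w) \<in> measurable M (path_space I)"
  using assms by (rule measurable_restrict)

text \<open>A finite measure on the product space is determined by the boxes over finite coordinate
  sets. Their probabilities are expectations of products of indicators, that is, the mixed
  expectations with every coordinate in an indicator and none left in the exponent.\<close>

lemma process_law_eqI:
  assumes M: "prob_space M" and N: "prob_space N"
    and X: "\<And>u. u \<in> I \<Longrightarrow> X u \<in> borel_measurable M"
    and Y: "\<And>u. u \<in> I \<Longrightarrow> Y u \<in> borel_measurable N"
    and eq: "\<And>J q. finite J \<Longrightarrow> J \<subseteq> I \<Longrightarrow>
      (CLINT w|M. iexp (\<Sum>j\<in>J. q j * X j w)) = (CLINT w|N. iexp (\<Sum>j\<in>J. q j * Y j w))"
  shows "process_law M I X = process_law N I Y"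
proof (rule measure_eqI_PiM_infinite)
  interpret M: prob_space M by fact
  interpret N: prob_space N by fact
  show "finite_measure (process_law M I X)"
    unfolding process_law_def using measurable_process[OF X] by (intro M.finite_measure_distr) 
  fix A :: "real \<Rightarrow> real set" and J
  assume J: "finite J" "J \<subseteq> I" and A: "\<And>i. i \<in> J \<Longrightarrow> A i \<in> sets borel"
  have law: "emeasure (process_law L I V) (prod_emb I (\<lambda>_. borel) J (Pi\<^sub>E J A)) =
      ennreal (LINT w|L. (\<Prod>j\<in>J. indicator (A j) (V j w)))"
    if L: "prob_space L" and V: "\<And>u. u \<in> I \<Longrightarrow> V u \<in> borel_measurable L" for L :: "'c measure" and V
  proof -
    interpret L: prob_space L by fact
    let ?E = "{w \<in> space L. \<forall>j\<in>J. V j w \<in> A j}"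
    have E: "(\<lambda>w. \<lambda>u\<in>I. V u w) -` prod_emb I (\<lambda>_. borel) J (Pi\<^sub>E J A) \<inter> space L = ?E"
      using J by (auto simp: prod_emb_iff PiE_iff restrict_PiE_iff subset_iff)
    have box: "prod_emb I (\<lambda>_. borel) J (Pi\<^sub>E J A) \<in> sets (path_space I)"
      using J A by (intro sets_PiM_I) auto
    have "?E \<in> sets L"
      using measurable_sets[OF measurable_process[of I V L] box] V E by simp
    have "(LINT w|L. (\<Prod>j\<in>J. indicator (A j) (V j w)) :: real) = (LINT w|L. indicator ?E w)"
      using J(1) by (intro Bochner_Integration.integral_cong) (auto simp: indicator_def prod_zero_iff split: if_splits)
    also have "ennreal \<dots> = emeasure L ?E"
      using \<open>?E \<in> sets L\<close> by (simp add: L.emeasure_eq_measure)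
    also have "\<dots> = emeasure (process_law L I V) (prod_emb I (\<lambda>_. borel) J (Pi\<^sub>E J A))"
      unfolding process_law_def using emeasure_distr[OF measurable_process[of I V L] box] V E by simp
    finally show ?thesis ..
  qed
  have "complex_of_real (LINT w|M. (\<Prod>j\<in>J. indicator (A j) (X j w))) = of_real (LINT w|N. (\<Prod>j\<in>J. indicator (A j) (Y j w)))"
    using joint_char_eq_imp_mixed[OF M N, of J X Y A J "{}"] X Y eq A J
    by (simp flip: integral_complex_of_real del: of_real_prod) (meson subset_iff order_trans)
  then show "emeasure (process_law M I X) (prod_emb I (\<lambda>_. borel) J (Pi\<^sub>E J A)) =
     emeasure (process_law N I Y) (prod_emb I (\<lambda>_. borel) J (Pi\<^sub>E J A))"
    using law[OF M X] law[OF N Y] by (simp only: of_real_eq_iff)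
qed (simp_all add: process_law_def)

subsection \<open>Intensity of the cones\<close>

text \<open>The quotient rule identifies the iterated \<open>deriv\<close> of
  \<open>ln (r t)\<close> on (0,1) with an explicit quotient in \<open>r\<close> and its first two
  derivatives. This makes \<open>- (deriv r t / r t)\<close> a primitive of the cone density over
  the squared height, with continuous derivative.\<close>

lemma admissible_kernel_log_derivs:
  assumes "admissible_kernel r" "0 < l" "l < 1"
  shows "((\<lambda>t. deriv r t / r t) has_real_derivative (deriv ^^ 2) (\<lambda>t. ln (r t)) l) (at l)"
    and "isCont ((deriv ^^ 2) (\<lambda>t. ln (r t))) l"
proof -
  have r: "0 < r t" "\<And>n. (deriv ^^ n) r differentiable (at t)" if "t \<in> {0<..<1}" for t
    using assms(1) that unfolding admissible_kernel_def by auto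
  have D: "((deriv ^^ n) r has_real_derivative (deriv ^^ Suc n) r t) (at t)" if "t \<in> {0<..<1}" for t n
    using r(2)[OF that, of n] by (simp add: DERIV_deriv_iff_real_differentiable)
  have D0: "(r has_real_derivative deriv r t) (at t)"
    and D1: "(deriv r has_real_derivative deriv (deriv r) t) (at t)" if "t \<in> {0<..<1}" for t
    using D[OF that, of 0] D[OF that, of 1] by simp_all
  have ln1: "((\<lambda>t. ln (r t)) has_real_derivative deriv r t / r t) (at t)" if "t \<in> {0<..<1}" for t
    using D0[OF that] r(1)[OF that] by (auto intro!: derivative_eq_intros simp: field_simps)
  define g where "g t = (deriv (deriv r) t * r t - deriv r t * deriv r t) / (r t * r t)" for t
  have ln2: "((\<lambda>t. deriv r t / r t) has_real_derivative g t) (at t)" if "t \<in> {0<..<1}" for t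
    unfolding g_def using D0[OF that] D1[OF that] r(1)[OF that]
    by (auto intro!: derivative_eq_intros)
  have deriv1: "deriv (\<lambda>t. ln (r t)) t = deriv r t / r t" if "t \<in> {0<..<1}" for t
    using ln1[OF that] by (rule DERIV_imp_deriv)
  \<comment> \<open>The outer \<open>deriv\<close> depends on the inner one in a neighbourhood of
    \<open>t\<close>, so the pointwise formula \<open>deriv1\<close> is needed eventually near
    \<open>t\<close>.\<close>
  have ev: "eventually (\<lambda>t. t \<in> {0<..<1}) (nhds t)" if "t \<in> {0<..<1}" for t :: real
    using that by (intro eventually_nhds_in_open) auto
  have deriv2: "(deriv ^^ 2) (\<lambda>t. ln (r t)) t = g t" if "t \<in> {0<..<1}" for t
  proof -
    have "(deriv ^^ 2) (\<lambda>t. ln (r t)) t = deriv (\<lambda>t. deriv r t / r t) t"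
      by (simp add: numeral_2_eq_2)
         (intro deriv_cong_ev refl eventually_mono[OF ev[OF that]] deriv1)
    also have "\<dots> = g t"
      using ln2[OF that] by (rule DERIV_imp_deriv)
    finally show ?thesis .
  qed
  have l: "l \<in> {0<..<1}"
    using assms by simp
  show "((\<lambda>t. deriv r t / r t) has_real_derivative (deriv ^^ 2) (\<lambda>t. ln (r t)) l) (at l)"
    using ln2[OF l] deriv2[OF l] by simp
  \<comment> \<open>Existence of the third derivative of \<open>r\<close> gives continuity of the
    second, the highest one in \<open>g\<close>.\<close>
  have "isCont g l"
    unfolding g_def using DERIV_isCont[OF D0[OF l]] DERIV_isCont[OF D1[OF l]] r(1)[OF l]
      DERIV_isCont[OF D[OF l, of 2]]
    by (auto intro!: continuous_intros simp: numeral_2_eq_2)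
  then show "isCont ((deriv ^^ 2) (\<lambda>t. ln (r t))) l"
    using isCont_cong[OF eventually_mono[OF ev[OF l] deriv2]] by simp
qed

text \<open>Below 1 the density is a continuous function times the squared height, and from 1 on it
  is constant. The indicator discards the arguments outside the half-plane.\<close>

lemma cone_density_measurable:
  assumes "admissible_kernel r"
  shows "(\<lambda>l. indicator {0<..} l * cone_density r l) \<in> borel_measurable borel"
proof -
  have "continuous_on {0<..<1} ((deriv ^^ 2) (\<lambda>t. ln (r t)))"
    using admissible_kernel_log_derivs(2)[OF assms]
    by (intro continuous_at_imp_continuous_on) auto
  then have [measurable]: "(\<lambda>l. indicator {0<..<1} l *\<^sub>R (deriv ^^ 2) (\<lambda>t. ln (r t)) l) \<in> borel_measurable borel"
    by (intro borel_measurable_continuous_on_indicator) auto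
  have "indicator {0<..} l * cone_density r l =
      - l\<^sup>2 * (indicator {0<..<1} l *\<^sub>R (deriv ^^ 2) (\<lambda>t. ln (r t)) l) +
      indicator {1..} l * vector_derivative (\<lambda>z. ln (r z)) (at_left 1)" for l
    by (auto simp: cone_density_def indicator_def)
  then show ?thesis
    by (simp only:) measurable
qed

text \<open>The integrand is minus the second derivative of \<open>ln (r t)\<close>, with primitive
  \<open>- (deriv r l / r l)\<close>. The primitive has finite limits at \<open>a\<close> and, by
  the one-sided regularity of \<open>r\<close>, at 1; as the integrand is nonnegative, the
  fundamental theorem of calculus yields integrability.\<close>

lemma set_integrable_cone_density:
  assumes r: "admissible_kernel r" and "0 < a" "a < 1"
  shows "set_integrable lborel {a<..<1} (\<lambda>l. cone_density r l / l\<^sup>2)"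
proof -
  let ?F = "\<lambda>l. - (deriv r l / r l)" and ?f = "\<lambda>l. - (deriv ^^ 2) (\<lambda>t. ln (r t)) l"
  obtain d where d: "(r has_real_derivative d) (at_left 1)" "(deriv r \<longlongrightarrow> d) (at_left 1)" and "r 1 = 1"
    using r unfolding admissible_kernel_def by auto
  have "(r \<longlongrightarrow> 1) (at_left 1)"
    using DERIV_continuous[OF d(1)] \<open>r 1 = 1\<close> by (simp add: continuous_within)
  then have "(?F \<longlongrightarrow> - (d / 1)) (at_left 1)"
    using d(2) by (intro tendsto_intros) auto
  moreover have "(?F \<longlongrightarrow> ?F a) (at_right a)"
    using DERIV_isCont[OF admissible_kernel_log_derivs(1)[OF r, of a]] assms
    by (intro tendsto_minus) (auto simp: isCont_def intro: filterlim_at_split[THEN iffD1, THEN conjunct2])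
  moreover have "0 \<le> ?f l" if "0 < l" "l < 1" for l
  proof -
    have "0 < cone_density r l"
      using r that unfolding admissible_kernel_def by auto
    then show ?thesis
      using that by (simp add: cone_density_def zero_less_mult_iff mult_less_0_iff)
  qed
  ultimately have int: "set_integrable lborel (einterval (ereal a) (ereal 1)) ?f"
    using assms admissible_kernel_log_derivs[OF r]
    by (intro interval_integral_FTC_nonneg(1)[where F = ?F])
       (auto simp: ereal_tendsto_simps intro!: derivative_intros continuous_intros)
  have "cone_density r l / l\<^sup>2 = ?f l" if "l \<in> {a<..<1}" for l
    using that assms by (simp add: cone_density_def)
  then have "set_integrable lborel {a<..<1} (\<lambda>l. cone_density r l / l\<^sup>2) \<longleftrightarrow> set_integrable lborel {a<..<1} ?f"
    by (intro set_integrable_cong refl)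
  with int show ?thesis
    by (simp add: einterval_eq)
qed

text \<open>The cone lies in a vertical strip of width 1 above a positive height, so its intensity
  is bounded by a one-dimensional integral in \<open>l\<close>. Near the bottom this is finite by
  \<open>set_integrable_cone_density\<close>, and above 1 the integrand is a constant over the
  squared height.\<close>

lemma cone_finite_sets:
  assumes r: "admissible_kernel r" and \<epsilon>: "0 < \<epsilon>"
  shows "cone \<epsilon> u \<in> finite_sets (intensity r)"
proof -
  \<comment> \<open>This is the density extended by zero to nonpositive heights, which makes it
    Borel on the whole line; on the half-plane nothing changes.\<close>
  define k where "k l = indicator {0<..} l * cone_density r l / l\<^sup>2" for l
  have [measurable]: "k \<in> borel_measurable borel"
    unfolding k_def using cone_density_measurable[OF r] by measurable
  have cone_nonneg: "0 \<le> cone_density r l" if "0 < l" for l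
    using r that unfolding admissible_kernel_def by (auto intro: less_imp_le)
  have half_plane[measurable]: "half_plane \<in> sets (borel \<Otimes>\<^sub>M borel)"
    using borel_measurable_less[of "\<lambda>_. 0" "borel \<Otimes>\<^sub>M borel" "snd :: real \<times> real \<Rightarrow> real"]
    by (simp add: half_plane_def space_pair_measure case_prod_unfold)
  have cone[measurable]: "cone \<epsilon> u \<in> sets (borel \<Otimes>\<^sub>M borel)"
  proof -
    have "{p \<in> space (borel \<Otimes>\<^sub>M borel). (\<epsilon> \<le> snd p \<and> snd p \<le> 1 \<and> \<bar>fst p - u\<bar> \<le> snd p / 2) \<or>
        (1 \<le> snd p \<and> \<bar>fst p - u\<bar> \<le> 1 / 2)} \<in> sets (borel \<Otimes>\<^sub>M borel)"
      by measurable
    then show ?thesis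
      by (simp add: cone_def space_pair_measure case_prod_unfold)
  qed
  have sub: "cone \<epsilon> u \<subseteq> half_plane"
    using \<epsilon> by (auto simp: cone_def half_plane_def)
  have sets: "cone \<epsilon> u \<in> sets (restrict_space lborel half_plane)"
    using cone sub half_plane unfolding borel_prod by (subst sets_restrict_space_iff) auto
  have "(\<lambda>(t, l). ennreal (k l)) \<in> borel_measurable (restrict_space lborel half_plane)"
    by (intro measurable_restrict_space1) (simp add: borel_prod[symmetric])
  moreover have "(\<lambda>(t, l). ennreal (k l)) x = (\<lambda>(t, l). ennreal (cone_density r l / l\<^sup>2)) x"
    if "x \<in> space (restrict_space lborel half_plane)" for x
    using that by (auto simp: k_def half_plane_def space_restrict_space)
  ultimately have meas: "(\<lambda>(t, l). ennreal (cone_density r l / l\<^sup>2)) \<in> borel_measurable (restrict_space lborel half_plane)"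
    by (subst (asm) measurable_cong) auto
  \<comment> \<open>Halving places \<open>a\<close> strictly below both \<epsilon> and 1, so that
    the cone lies above height \<open>a\<close> and the interval from \<open>a\<close> to 1 is
    nonempty even for \<epsilon> = 1.\<close>
  define a where "a = min \<epsilon> 1 / 2"
  have a: "0 < a" "a < 1" "a < \<epsilon>"
    using \<epsilon> by (auto simp: a_def min_def)
  let ?T = "{u - 1/2..u + 1/2}"
  have "emeasure (intensity r) (cone \<epsilon> u) =
      (\<integral>\<^sup>+x. (\<lambda>(t, l). ennreal (cone_density r l / l\<^sup>2)) x * indicator (cone \<epsilon> u) x * indicator half_plane x \<partial>lborel)"
    unfolding intensity_def using meas sets half_plane[unfolded borel_prod]
    by (subst emeasure_density) (auto simp: nn_integral_restrict_space)
  \<comment> \<open>At every height the cone stays within distance 1/2 of \<open>u\<close>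
    horizontally, so a product set contains it and the integral factorises.\<close>
  also have "\<dots> \<le> (\<integral>\<^sup>+x. (\<lambda>(t, l). indicator ?T t * (ennreal (k l) * indicator {a<..} l)) x \<partial>lborel)"
    using a sub by (intro nn_integral_mono)
      (auto simp: cone_def half_plane_def k_def indicator_def abs_le_iff split: if_splits)
  also have "\<dots> = (\<integral>\<^sup>+t. (\<integral>\<^sup>+l. indicator ?T t * (ennreal (k l) * indicator {a<..} l) \<partial>lborel) \<partial>lborel)"
    unfolding lborel_prod[symmetric] by (subst lborel.nn_integral_fst[symmetric]) auto
  also have "\<dots> = (\<integral>\<^sup>+t. indicator ?T t \<partial>lborel) * (\<integral>\<^sup>+l. ennreal (k l) * indicator {a<..} l \<partial>lborel)"
    by (simp add: nn_integral_cmult nn_integral_multc)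
  also have "(\<integral>\<^sup>+t. indicator ?T t \<partial>lborel) = 1"
    by simp
  also have "(\<integral>\<^sup>+l. ennreal (k l) * indicator {a<..} l \<partial>lborel) =
      (\<integral>\<^sup>+l. ennreal (k l) * indicator {a<..<1} l + ennreal (k l) * indicator {1..} l \<partial>lborel)"
    using a by (intro nn_integral_cong) (auto simp: indicator_def)
  also have "\<dots> = (\<integral>\<^sup>+l. ennreal (k l) * indicator {a<..<1} l \<partial>lborel) + (\<integral>\<^sup>+l. ennreal (k l) * indicator {1..} l \<partial>lborel)"
    by (intro nn_integral_add) auto
  finally have bound: "emeasure (intensity r) (cone \<epsilon> u) \<le>
      1 * ((\<integral>\<^sup>+l. ennreal (k l) * indicator {a<..<1} l \<partial>lborel) + (\<integral>\<^sup>+l. ennreal (k l) * indicator {1..} l \<partial>lborel))" .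
  have tail: "(\<integral>\<^sup>+l. ennreal (k l) * indicator {1..} l \<partial>lborel) < \<infinity>"
  proof -
    define d where "d = vector_derivative (\<lambda>z. ln (r z)) (at_left 1)"
    have "d \<ge> 0"
      using cone_nonneg[of 1] by (simp add: cone_density_def d_def)
    have "(\<integral>\<^sup>+l. ennreal (k l) * indicator {1..} l \<partial>lborel) = (\<integral>\<^sup>+l. ennreal (d / l\<^sup>2) * indicator {1..} l \<partial>lborel)"
      by (intro nn_integral_cong) (auto simp: k_def cone_density_def d_def indicator_def)
    also have "\<dots> = ennreal (0 - (- d / 1))"
    proof (rule nn_integral_FTC_atLeast)
      show "((\<lambda>l. - d / l) has_real_derivative d / l\<^sup>2) (at l)" if "1 \<le> l" for l
        using that by (auto intro!: derivative_eq_intros simp: power2_eq_square)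
      show "((\<lambda>l. - d / l) \<longlongrightarrow> 0) at_top"
        by (intro tendsto_divide_0[OF tendsto_const] filterlim_at_top_imp_at_infinity filterlim_ident)
    qed (use \<open>d \<ge> 0\<close> in auto)
    finally show ?thesis
      by simp
  qed
  have near: "(\<integral>\<^sup>+l. ennreal (k l) * indicator {a<..<1} l \<partial>lborel) < \<infinity>"
  proof -
    have "(\<integral>\<^sup>+l. ennreal (k l) * indicator {a<..<1} l \<partial>lborel) =
        (\<integral>\<^sup>+l. ennreal (norm (indicator {a<..<1} l *\<^sub>R (cone_density r l / l\<^sup>2))) \<partial>lborel)"
      using a cone_nonneg by (intro nn_integral_cong) (auto simp: k_def indicator_def)
    also have "\<dots> < \<infinity>"
      using set_integrable_cone_density[OF r a(1,2)] unfolding set_integrable_def integrable_iff_bounded by simp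
    finally show ?thesis .
  qed
  have "emeasure (intensity r) (cone \<epsilon> u) < \<infinity>"
    using bound by (rule order.strict_trans1) (use near tail in simp)
  then show ?thesis
    using sets by (simp add: finite_sets_def intensity_def)
qed

subsection \<open>Joint characteristic functions of the fields\<close>

text \<open>Composition with \<open>f\<close> and \<open>g\<close> brings \<open>X\<close> and
  \<open>Y\<close> into the common value type of complex numbers, where the product rule for
  \<open>indep_var\<close> applies. Independence survives because each preimage under
  \<open>f \<circ> X\<close> is a preimage under \<open>X\<close>, and likewise for
  \<open>Y\<close>.\<close>

lemma independent_rvs_expectation_mult:
  fixes f :: "'x \<Rightarrow> complex" and g :: "'y \<Rightarrow> complex"
  assumes M: "prob_space M" and ind: "independent_rvs M A X B Y"
    and [measurable]: "f \<in> borel_measurable A" "g \<in> borel_measurable B"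
    and bd: "\<And>x. norm (f x) \<le> C" "\<And>y. norm (g y) \<le> C"
  shows "(CLINT w|M. f (X w) * g (Y w)) = (CLINT w|M. f (X w)) * (CLINT w|M. g (Y w))"
proof -
  interpret prob_space M by fact
  have [measurable]: "X \<in> measurable M A" "Y \<in> measurable M B"
    and indep: "indep_set {X -` S \<inter> space M |S. S \<in> sets A} {Y -` S \<inter> space M |S. S \<in> sets B}"
    using ind unfolding independent_rvs_def by auto
  have preimage: "{(h \<circ> Z) -` S \<inter> space M |S. S \<in> sets borel} \<subseteq> {Z -` S \<inter> space M |S. S \<in> sets D}"
    if [measurable]: "Z \<in> measurable M D" "h \<in> borel_measurable D" for Z D and h :: "'z \<Rightarrow> complex"
  proof safe
    fix S :: "complex set" assume "S \<in> sets borel"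
    then have "h -` S \<inter> space D \<in> sets D"
      by simp
    moreover have "(h \<circ> Z) -` S \<inter> space M = Z -` (h -` S \<inter> space D) \<inter> space M"
      using measurable_space[OF that(1)] by auto
    ultimately show "\<exists>S'. (h \<circ> Z) -` S \<inter> space M = Z -` S' \<inter> space M \<and> S' \<in> sets D"
      by blast
  qed
  \<comment> \<open>Needed to extend independence from the families of preimages to the
    sigma-algebras that they generate, as \<open>indep_var_eq\<close> demands.\<close>
  have Int_stable: "Int_stable {Z -` S \<inter> space M |S. S \<in> sets D}" for Z :: "'a \<Rightarrow> 'z" and D
  proof (safe intro!: Int_stableI)
    fix S T assume "S \<in> sets D" "T \<in> sets D"
    then show "\<exists>U. (Z -` S \<inter> space M) \<inter> (Z -` T \<inter> space M) = Z -` U \<inter> space M \<and> U \<in> sets D"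
      by (intro exI[of _ "S \<inter> T"]) auto
  qed
  have "indep_var borel (f \<circ> X) borel (g \<circ> Y)"
    unfolding indep_var_eq
  proof (intro conjI indep_set_sigma_sets Int_stable)
    show "indep_set {(f \<circ> X) -` S \<inter> space M |S. S \<in> sets borel} {(g \<circ> Y) -` S \<inter> space M |S. S \<in> sets borel}"
      using indep preimage[of X A f] preimage[of Y B g] unfolding indep_set_def
      by (elim indep_sets_mono_sets) (auto split: bool.split)
  qed measurable
  moreover have "integrable M (f \<circ> X)" "integrable M (g \<circ> Y)"
    using bd by (auto intro!: integrable_bounded[of _ C])
  ultimately show ?thesis
    using indep_var_lebesgue_integral[of "f \<circ> X" "g \<circ> Y"] by (simp add: comp_def)
qed

section \<open>Independently scattered measures on finite families of sets\<close>

lemma finite_sets_empty: "{} \<in> finite_sets \<rho>"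
  by (simp add: finite_sets_def)

lemma finite_sets_subset: "A \<in> finite_sets \<rho> \<Longrightarrow> B \<in> sets \<rho> \<Longrightarrow> B \<subseteq> A \<Longrightarrow> B \<in> finite_sets \<rho>"
  unfolding finite_sets_def using emeasure_mono[of B A \<rho>] by (auto intro: order.strict_trans1)

text \<open>Translates finite families into sequences, the form in which
  \<open>id_random_measure\<close> states independence and additivity; the sequence is padded with
  empty sets.\<close>

lemma finite_disjoint_family_enum:
  assumes "finite I" "disjoint_family_on B I" "\<And>i. i \<in> I \<Longrightarrow> B i \<in> finite_sets \<rho>"
  obtains h A where "bij_betw h {..<card I} I" "\<And>n. n < card I \<Longrightarrow> A n = B (h n)"
    "\<And>n. card I \<le> n \<Longrightarrow> A n = {}" "range A \<subseteq> finite_sets \<rho>" "disjoint_family A" "(\<Union>n. A n) = (\<Union>i\<in>I. B i)"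
proof -
  obtain h where h: "bij_betw h {..<card I} I"
    using ex_bij_betw_nat_finite[OF assms(1)] by (auto simp: atLeast0LessThan)
  define A where "A n = (if n < card I then B (h n) else {})" for n
  have hI: "h n \<in> I" if "n < card I" for n
    using bij_betwE[OF h] that by auto
  have h_inj: "h m \<noteq> h n" if "m < card I" "n < card I" "m \<noteq> n" for m n
    using bij_betw_imp_inj_on[OF h] that by (auto dest: inj_onD)
  have "disjoint_family A"
    using assms(2) hI h_inj unfolding disjoint_family_on_def A_def by auto
  moreover have "(\<Union>n. A n) = (\<Union>n\<in>{..<card I}. B (h n))"
    by (auto simp: A_def split: if_splits)
  then have "(\<Union>n. A n) = (\<Union>i\<in>I. B i)"
    using bij_betw_imp_surj_on[OF h] by (simp flip: image_image)
  moreover have "range A \<subseteq> finite_sets \<rho>"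
    using assms(3) hI by (auto simp: A_def finite_sets_empty)
  ultimately show thesis
    using h by (intro that[of h A]) (auto simp: A_def)
qed

text \<open>The constant sequence of empty sets is disjoint with empty union, so a series with
  constant terms converges almost surely, which forces the terms to vanish.\<close>

lemma id_random_measure_empty:
  assumes "id_random_measure M \<phi> \<rho> \<mu> P"
  shows "AE w in M. P {} w = 0"
proof -
  have "AE w in M. (\<lambda>n::nat. P {} w) sums P {} w"
    using assms finite_sets_empty[of \<rho>] unfolding id_random_measure_def
    by (auto simp: disjoint_family_on_def dest!: spec[of _ "\<lambda>_. {}"])
  then show ?thesis
  proof eventually_elim
    case (elim w)
    then have "summable (\<lambda>n::nat. P {} w)"
      by (rule sums_summable)
    then show ?case
      using summable_LIMSEQ_zero LIMSEQ_const_iff by blast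
  qed
qed

text \<open>The padding sets contribute zero almost surely, so the series from countable additivity
  stops after \<open>card I\<close> terms.\<close>

lemma id_random_measure_finite_additive:
  assumes P: "id_random_measure M \<phi> \<rho> \<mu> P" and "finite I" "disjoint_family_on B I"
    and B: "\<And>i. i \<in> I \<Longrightarrow> B i \<in> finite_sets \<rho>" and U: "(\<Union>i\<in>I. B i) \<in> finite_sets \<rho>"
  shows "AE w in M. P (\<Union>i\<in>I. B i) w = (\<Sum>i\<in>I. P (B i) w)"
proof -
  obtain h A where h: "bij_betw h {..<card I} I" and A: "\<And>n. n < card I \<Longrightarrow> A n = B (h n)"
    "\<And>n. card I \<le> n \<Longrightarrow> A n = {}" "range A \<subseteq> finite_sets \<rho>" "disjoint_family A" "(\<Union>n. A n) = (\<Union>i\<in>I. B i)"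
    using finite_disjoint_family_enum[OF assms(2,3) B] by metis
  have "AE w in M. (\<lambda>n. P (A n) w) sums P (\<Union>n. A n) w"
    using P A(3-5) U unfolding id_random_measure_def by metis
  then show ?thesis
    using id_random_measure_empty[OF P]
  proof eventually_elim
    case (elim w)
    have "(\<lambda>n. P (A n) w) sums (\<Sum>n<card I. P (A n) w)"
      using elim(2) A(2) by (intro sums_finite) auto
    also have "(\<Sum>n<card I. P (A n) w) = (\<Sum>n<card I. P (B (h n)) w)"
      using A(1) by simp
    also have "\<dots> = (\<Sum>i\<in>I. P (B i) w)"
      by (rule sum.reindex_bij_betw[OF h])
    finally show ?case
      using elim(1) A(5) by (metis sums_unique2)
  qed
qed

text \<open>The exponential of the sum is a product of bounded functions of independent variables,
  so its expectation is the product of the individual characteristic functions.\<close>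

lemma id_random_measure_char_disjoint:
  assumes M: "prob_space M" and P: "id_random_measure M \<phi> \<rho> \<mu> P" and "finite I" "disjoint_family_on B I"
    and B: "\<And>i. i \<in> I \<Longrightarrow> B i \<in> finite_sets \<rho>"
  shows "(CLINT w|M. iexp (\<Sum>i\<in>I. a i * P (B i) w)) =
    exp (of_real \<mu> * (\<Sum>i\<in>I. \<phi> (of_real (a i)) * of_real (measure \<rho> (B i))))"
proof -
  interpret prob_space M by fact
  obtain h A where h: "bij_betw h {..<card I} I" and A: "\<And>n. n < card I \<Longrightarrow> A n = B (h n)"
    "range A \<subseteq> finite_sets \<rho>" "disjoint_family A"
    using finite_disjoint_family_enum[OF assms(3,4) B] by metis
  have meas: "P (A n) \<in> borel_measurable M" for n
    using P A(2) unfolding id_random_measure_def by auto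
  have "indep_vars (\<lambda>_. borel) (\<lambda>n. P (A n)) UNIV"
    using P A(2,3) unfolding id_random_measure_def by metis
  then have "indep_vars (\<lambda>_. borel) (\<lambda>n. P (A n)) {..<card I}"
    by (rule indep_vars_subset) simp
  then have "indep_vars (\<lambda>_. borel) (\<lambda>n w. iexp (a (h n) * P (A n) w)) {..<card I}"
    by (rule indep_vars_compose2) measurable
  moreover have "(\<Prod>n<card I. iexp (a (h n) * P (A n) w)) = iexp (\<Sum>i\<in>I. a i * P (B i) w)" for w
    using A(1) sum.reindex_bij_betw[OF h, of "\<lambda>i. a i * P (B i) w", symmetric]
    by (simp add: sum_distrib_left flip: exp_sum of_real_mult)
  moreover have "integrable M (\<lambda>w. iexp (a (h n) * P (A n) w))" for n
    using meas[of n] by (intro integrable_bounded[of _ 1]) auto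
  ultimately have "(CLINT w|M. iexp (\<Sum>i\<in>I. a i * P (B i) w)) = (\<Prod>n<card I. CLINT w|M. iexp (a (h n) * P (A n) w))"
    using indep_vars_lebesgue_integral[of "{..<card I}" "\<lambda>n w. iexp (a (h n) * P (A n) w)"]
    by simp
  also have "\<dots> = (\<Prod>n<card I. exp (of_real \<mu> * \<phi> (of_real (a (h n))) * of_real (measure \<rho> (A n))))"
  proof (intro prod.cong refl)
    fix n
    have "A n \<in> finite_sets \<rho>"
      using A(2) by auto
    then show "(CLINT w|M. iexp (a (h n) * P (A n) w)) = exp (of_real \<mu> * \<phi> (of_real (a (h n))) * of_real (measure \<rho> (A n)))"
      using P unfolding id_random_measure_def by (simp add: mult.assoc)
  qed
  also have "\<dots> = exp (of_real \<mu> * (\<Sum>n<card I. \<phi> (of_real (a (h n))) * of_real (measure \<rho> (B (h n)))))"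
    using A(1) by (simp add: sum_distrib_left mult.assoc flip: exp_sum)
  also have "(\<Sum>n<card I. \<phi> (of_real (a (h n))) * complex_of_real (measure \<rho> (B (h n)))) =
      (\<Sum>i\<in>I. \<phi> (of_real (a i)) * of_real (measure \<rho> (B i)))"
    by (rule sum.reindex_bij_betw[OF h])
  finally show ?thesis .
qed

text \<open>The cells are pairwise disjoint for distinct subsets \<open>S\<close> of
  \<open>J\<close>. The cell of the empty set is the complement of all \<open>C j\<close> and need
  not have finite intensity, so sums over cells run over nonempty \<open>S\<close>.\<close>

definition venn_cell :: "'i set \<Rightarrow> ('i \<Rightarrow> 'x set) \<Rightarrow> 'i set \<Rightarrow> 'x set" where
  "venn_cell J C S = {x. \<forall>j\<in>J. x \<in> C j \<longleftrightarrow> j \<in> S}"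

text \<open>Each \<open>C j\<close> is the disjoint union of the cells with
  \<open>j \<in> S\<close>. Almost surely the linear combination of the \<open>P (C j)\<close> is
  therefore one of the cell values, where the cell of \<open>S\<close> has the coefficient
  \<open>\<Sum>j\<in>S. q j\<close>, and the disjoint case applies.\<close>

lemma id_random_measure_joint_char:
  assumes M: "prob_space M" and P: "id_random_measure M \<phi> \<rho> \<mu> P" and J: "finite J"
    and C: "\<And>j. j \<in> J \<Longrightarrow> C j \<in> finite_sets \<rho>"
  shows "(CLINT w|M. iexp (\<Sum>j\<in>J. q j * P (C j) w)) =
    exp (of_real \<mu> * (\<Sum>S\<in>Pow J - {{}}. \<phi> (of_real (\<Sum>j\<in>S. q j)) * of_real (measure \<rho> (venn_cell J C S))))"
proof -
  interpret prob_space M by fact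
  let ?I = "Pow J - {{}}" and ?B = "venn_cell J C"
  have B: "?B S \<in> finite_sets \<rho>" if S: "S \<in> ?I" for S
  proof -
    \<comment> \<open>A nonempty \<open>S\<close> supplies a set \<open>C k\<close> containing the
      cell, which places the cell inside the space and bounds its intensity.\<close>
    obtain k where k: "k \<in> S" "k \<in> J"
      using S by auto
    have "?B S = {x \<in> space \<rho>. \<forall>j\<in>J. x \<in> C j \<longleftrightarrow> j \<in> S}"
      using k sets.sets_into_space[of "C k" \<rho>] C[of k] by (auto simp: venn_cell_def finite_sets_def)
    also have "\<dots> \<in> sets \<rho>"
    proof (rule sets.sets_Collect_finite_All[OF _ J])
      fix j assume "j \<in> J"
      then have Cj: "C j \<in> sets \<rho>"
        using C by (simp add: finite_sets_def)
      then have "{x \<in> space \<rho>. x \<in> C j \<longleftrightarrow> j \<in> S} = (if j \<in> S then C j else space \<rho> - C j)"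
        using sets.sets_into_space[OF Cj] by auto
      then show "{x \<in> space \<rho>. x \<in> C j \<longleftrightarrow> j \<in> S} \<in> sets \<rho>"
        using Cj by auto
    qed
    finally have "?B S \<in> sets \<rho>" .
    then show ?thesis
      using finite_sets_subset[OF C[of k], of "?B S"] k by (auto simp: venn_cell_def)
  qed
  have disj: "disjoint_family_on ?B (Pow J)"
    by (auto simp: disjoint_family_on_def venn_cell_def)
  have "AE w in M. P (C j) w = (\<Sum>S\<in>{S \<in> Pow J. j \<in> S}. P (?B S) w)" if "j \<in> J" for j
  proof -
    \<comment> \<open>The cell containing \<open>x\<close> is the one indexed by all sets of the
      family to which \<open>x\<close> belongs.\<close>
    have "x \<in> (\<Union>S\<in>{S \<in> Pow J. j \<in> S}. ?B S)" if "x \<in> C j" for x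
      using that \<open>j \<in> J\<close> by (auto simp: venn_cell_def intro!: exI[of _ "{i \<in> J. x \<in> C i}"])
    then have "(\<Union>S\<in>{S \<in> Pow J. j \<in> S}. ?B S) = C j"
      using \<open>j \<in> J\<close> by (auto simp: venn_cell_def)
    then show ?thesis
      using id_random_measure_finite_additive[OF P, of "{S \<in> Pow J. j \<in> S}" ?B] J B C[OF that]
        disjoint_family_on_mono[OF _ disj, of "{S \<in> Pow J. j \<in> S}"] by auto
  qed
  then have "AE w in M. \<forall>j\<in>J. P (C j) w = (\<Sum>S\<in>{S \<in> Pow J. j \<in> S}. P (?B S) w)"
    using J by (intro AE_finite_allI) auto
  then have ae: "AE w in M. (\<Sum>j\<in>J. q j * P (C j) w) = (\<Sum>S\<in>?I. (\<Sum>j\<in>S. q j) * P (?B S) w)"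
  proof eventually_elim
    case (elim w)
    \<comment> \<open>The condition \<open>j \<in> S\<close> already excludes the empty set, so the
      index set may be cut down to nonempty \<open>S\<close> before the sums are exchanged.\<close>
    have "(\<Sum>j\<in>J. q j * P (C j) w) = (\<Sum>j\<in>J. \<Sum>S\<in>{S \<in> ?I. j \<in> S}. q j * P (?B S) w)"
      using elim by (auto simp: sum_distrib_left intro!: sum.cong)
    also have "\<dots> = (\<Sum>S\<in>?I. \<Sum>j\<in>{j \<in> J. j \<in> S}. q j * P (?B S) w)"
      using J by (intro sum.swap_restrict) auto
    also have "\<dots> = (\<Sum>S\<in>?I. (\<Sum>j\<in>S. q j) * P (?B S) w)"
      by (auto simp: sum_distrib_right intro!: sum.cong)
    finally show ?case .
  qed
  have "(CLINT w|M. iexp (\<Sum>j\<in>J. q j * P (C j) w)) = (CLINT w|M. iexp (\<Sum>S\<in>?I. (\<Sum>j\<in>S. q j) * P (?B S) w))"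
  proof (rule integral_cong_AE)
    have [measurable]: "P A \<in> borel_measurable M" if "A \<in> finite_sets \<rho>" for A
      using P that unfolding id_random_measure_def by auto
    show "(\<lambda>w. iexp (\<Sum>j\<in>J. q j * P (C j) w)) \<in> borel_measurable M"
      "(\<lambda>w. iexp (\<Sum>S\<in>?I. (\<Sum>j\<in>S. q j) * P (?B S) w)) \<in> borel_measurable M"
      using B C by measurable
    show "AE w in M. iexp (\<Sum>j\<in>J. q j * P (C j) w) = iexp (\<Sum>S\<in>?I. (\<Sum>j\<in>S. q j) * P (?B S) w)"
      using ae by eventually_elim simp
  qed
  then show ?thesis
    using id_random_measure_char_disjoint[OF M P _ disjoint_family_on_mono[OF _ disj] B, of ?I "\<lambda>S. \<Sum>j\<in>S. q j"] J
    by auto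
qed

section \<open>Characteristic functions of the extended fields\<close>

lemma measurable_path_linear:
  "(\<lambda>y. iexp (\<Sum>j\<in>J. q j * y j)) \<in> borel_measurable (path_space UNIV)"
  by measurable

text \<open>The variable \<open>Z\<close> is common to all times, so it enters the linear
  combination with the sum of the coefficients; by independence its characteristic function splits
  off from that of the cone values.\<close>

lemma extended_field_joint_char:
  assumes M: "prob_space M" and r: "admissible_kernel r" and \<epsilon>: "0 < \<epsilon>"
    and W: "extended_field M \<phi> (intensity r) \<mu> L \<epsilon> W" and J: "finite J"
  shows "(CLINT w|M. iexp (\<Sum>j\<in>J. q j * W j w)) =
    exp (of_real \<mu> * ((\<Sum>S\<in>Pow J - {{}}. \<phi> (of_real (\<Sum>j\<in>S. q j)) *
           of_real (measure (intensity r) (venn_cell J (cone \<epsilon>) S))) +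
         \<phi> (of_real (\<Sum>j\<in>J. q j)) * of_real (ln L)))"
proof -
  obtain P Z where P: "id_random_measure M \<phi> (intensity r) \<mu> P"
    and ind: "independent_rvs M borel Z (path_space UNIV) (\<lambda>w u. P (cone \<epsilon> u) w)"
    and Z: "\<And>q::real. (CLINT w | M. exp (\<i> * of_real q * of_real (Z w))) =
           exp (of_real \<mu> * \<phi> (of_real q) * of_real (ln L))"
    and W_eq: "W = (\<lambda>u w. P (cone \<epsilon> u) w + Z w)"
    using W unfolding extended_field_def by auto
  let ?s = "\<Sum>j\<in>J. q j"
  have "(\<Sum>j\<in>J. q j * W j w) = ?s * Z w + (\<Sum>j\<in>J. q j * P (cone \<epsilon> j) w)" for w
    by (simp add: W_eq distrib_left sum.distrib sum_distrib_right)
  then have "(CLINT w|M. iexp (\<Sum>j\<in>J. q j * W j w)) =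
      (CLINT w|M. iexp (?s * Z w) * iexp (\<Sum>j\<in>J. q j * P (cone \<epsilon> j) w))"
    by (simp only: of_real_add distrib_left exp_add)
  also have "\<dots> = (CLINT w|M. iexp (?s * Z w)) * (CLINT w|M. iexp (\<Sum>j\<in>J. q j * P (cone \<epsilon> j) w))"
    using independent_rvs_expectation_mult[OF M ind, of "\<lambda>z. iexp (?s * z)" "\<lambda>y. iexp (\<Sum>j\<in>J. q j * y j)" 1]
      measurable_path_linear by simp
  also have "(CLINT w|M. iexp (?s * Z w)) = exp (of_real \<mu> * \<phi> (of_real ?s) * of_real (ln L))"
    using Z[of ?s] by (simp add: mult.assoc)
  also have "(CLINT w|M. iexp (\<Sum>j\<in>J. q j * P (cone \<epsilon> j) w)) =
      exp (of_real \<mu> * (\<Sum>S\<in>Pow J - {{}}. \<phi> (of_real (\<Sum>j\<in>S. q j)) *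
        of_real (measure (intensity r) (venn_cell J (cone \<epsilon>) S))))"
    by (rule id_random_measure_joint_char[OF M P J cone_finite_sets[OF r \<epsilon>]])
  finally show ?thesis
    by (simp add: algebra_simps flip: exp_add)
qed

theorem theorem3p1:
  fixes \<sigma> \<mu> L \<epsilon> \<delta> :: real
    and \<nu> :: "real measure"
    and r :: "real \<Rightarrow> real"
    and \<Omega> :: "'a measure" and \<Omega>' :: "'b measure"
    and X W :: "real \<Rightarrow> 'a \<Rightarrow> real"
    and W\<^sub>1 W\<^sub>2 :: "real \<Rightarrow> 'b \<Rightarrow> real"
  defines "\<phi> \<equiv> id_exponent \<sigma> \<nu>"
  assumes "spectral_measure \<nu>"
    and "admissible_kernel r"
    and "0 < \<mu>" and "nondegenerate \<sigma> \<nu> \<mu>"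
    and "1 \<le> L" and "0 < \<epsilon>" and "\<epsilon> \<le> 1" and "0 < \<delta>" and "\<delta> < \<mu>"
    and "prob_space \<Omega>" and "prob_space \<Omega>'"
    and "extended_field \<Omega> \<phi> (intensity r) \<mu> L \<epsilon> W"
    and "levy_process \<Omega> X"
    and "\<forall>q::real. (CLINT w | \<Omega>. exp (\<i> * of_real q * of_real (X \<delta> w))) = exp (of_real \<delta> * \<phi> (of_real q))"
    and "independent_rvs \<Omega> borel (X \<delta>) (path_space UNIV) (\<lambda>w u. W u w)"
    and "extended_field \<Omega>' \<phi> (intensity r) (\<mu> - \<delta>) L \<epsilon> W\<^sub>1"
    and "extended_field \<Omega>' \<phi> (intensity r) \<delta> (exp 1 * L) \<epsilon> W\<^sub>2"
    and "independent_rvs \<Omega>' (path_space UNIV) (\<lambda>w u. W\<^sub>1 u w) (path_space UNIV) (\<lambda>w u. W\<^sub>2 u w)"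
  shows "process_law \<Omega> {0..1} (\<lambda>u w. X \<delta> w + W u w) =
         process_law \<Omega>' {0..1} (\<lambda>u w. W\<^sub>1 u w + W\<^sub>2 u w)"
proof (rule process_law_eqI)
  note kernel = \<open>admissible_kernel r\<close> \<open>0 < \<epsilon>\<close>
  note ind = \<open>independent_rvs \<Omega> borel (X \<delta>) (path_space UNIV) (\<lambda>w u. W u w)\<close>
  note ind' = \<open>independent_rvs \<Omega>' (path_space UNIV) (\<lambda>w u. W\<^sub>1 u w) (path_space UNIV) (\<lambda>w u. W\<^sub>2 u w)\<close>
  \<comment> \<open>Independence provides measurability of whole paths only; composing with a
    coordinate projection gives it at each single time.\<close>
  have component: "V u \<in> borel_measurable M" if "(\<lambda>w u. V u w) \<in> measurable M (path_space UNIV)"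
    for M :: "'c measure" and V and u :: real
    using measurable_compose[OF that measurable_component_singleton[of u]] by simp
  show "(\<lambda>w. X \<delta> w + W u w) \<in> borel_measurable \<Omega>" for u
    using ind component[of W \<Omega> u] by (auto simp: independent_rvs_def)
  show "(\<lambda>w. W\<^sub>1 u w + W\<^sub>2 u w) \<in> borel_measurable \<Omega>'" for u
    using ind' component[of W\<^sub>1 \<Omega>' u] component[of W\<^sub>2 \<Omega>' u] by (auto simp: independent_rvs_def)
  fix J :: "real set" and q :: "real \<Rightarrow> real"
  assume J: "finite J"
  let ?s = "\<Sum>j\<in>J. q j"
  \<comment> \<open>The cone contribution per unit of intermittency, the same for \<open>W\<close>,
    \<open>W\<^sub>1\<close> and \<open>W\<^sub>2\<close>.\<close>
  define \<kappa> where "\<kappa> = (\<Sum>S\<in>Pow J - {{}}. \<phi> (of_real (\<Sum>j\<in>S. q j)) *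
    complex_of_real (measure (intensity r) (venn_cell J (cone \<epsilon>) S)))"
  have "(\<Sum>j\<in>J. q j * (X \<delta> w + W j w)) = ?s * X \<delta> w + (\<Sum>j\<in>J. q j * W j w)" for w
    by (simp add: distrib_left sum.distrib sum_distrib_right)
  then have "(CLINT w|\<Omega>. iexp (\<Sum>j\<in>J. q j * (X \<delta> w + W j w))) =
      (CLINT w|\<Omega>. iexp (?s * X \<delta> w) * iexp (\<Sum>j\<in>J. q j * W j w))"
    by (simp only: of_real_add distrib_left exp_add)
  also have "\<dots> = (CLINT w|\<Omega>. iexp (?s * X \<delta> w)) * (CLINT w|\<Omega>. iexp (\<Sum>j\<in>J. q j * W j w))"
    using independent_rvs_expectation_mult[OF \<open>prob_space \<Omega>\<close> ind, of "\<lambda>x. iexp (?s * x)" "\<lambda>y. iexp (\<Sum>j\<in>J. q j * y j)" 1]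
      measurable_path_linear by simp
  also have "(CLINT w|\<Omega>. iexp (?s * X \<delta> w)) = exp (of_real \<delta> * \<phi> (of_real ?s))"
    using assms(15)[rule_format, of ?s] by (simp add: mult.assoc)
  also have "(CLINT w|\<Omega>. iexp (\<Sum>j\<in>J. q j * W j w)) = exp (of_real \<mu> * (\<kappa> + \<phi> (of_real ?s) * of_real (ln L)))"
    unfolding \<kappa>_def by (rule extended_field_joint_char[OF \<open>prob_space \<Omega>\<close> kernel assms(13) J])
  finally have lhs: "(CLINT w|\<Omega>. iexp (\<Sum>j\<in>J. q j * (X \<delta> w + W j w))) =
      exp (of_real \<delta> * \<phi> (of_real ?s)) * exp (of_real \<mu> * (\<kappa> + \<phi> (of_real ?s) * of_real (ln L)))" .
  have "(CLINT w|\<Omega>'. iexp (\<Sum>j\<in>J. q j * (W\<^sub>1 j w + W\<^sub>2 j w))) =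
      (CLINT w|\<Omega>'. iexp (\<Sum>j\<in>J. q j * W\<^sub>1 j w) * iexp (\<Sum>j\<in>J. q j * W\<^sub>2 j w))"
    by (simp add: distrib_left sum.distrib exp_add)
  also have "\<dots> = (CLINT w|\<Omega>'. iexp (\<Sum>j\<in>J. q j * W\<^sub>1 j w)) * (CLINT w|\<Omega>'. iexp (\<Sum>j\<in>J. q j * W\<^sub>2 j w))"
    using independent_rvs_expectation_mult[OF \<open>prob_space \<Omega>'\<close> ind', of "\<lambda>y. iexp (\<Sum>j\<in>J. q j * y j)" "\<lambda>y. iexp (\<Sum>j\<in>J. q j * y j)" 1]
      measurable_path_linear by simp
  also have "(CLINT w|\<Omega>'. iexp (\<Sum>j\<in>J. q j * W\<^sub>1 j w)) =
      exp (of_real (\<mu> - \<delta>) * (\<kappa> + \<phi> (of_real ?s) * of_real (ln L)))"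
    unfolding \<kappa>_def by (rule extended_field_joint_char[OF \<open>prob_space \<Omega>'\<close> kernel assms(17) J])
  also have "(CLINT w|\<Omega>'. iexp (\<Sum>j\<in>J. q j * W\<^sub>2 j w)) =
      exp (of_real \<delta> * (\<kappa> + \<phi> (of_real ?s) * of_real (ln (exp 1 * L))))"
    unfolding \<kappa>_def by (rule extended_field_joint_char[OF \<open>prob_space \<Omega>'\<close> kernel assms(18) J])
  \<comment> \<open>The summand 1 reproduces the exponent of \<open>X \<delta>\<close>. The
    remaining terms combine because the intermittencies \<mu> - \<delta> and \<delta> add up to
    \<mu>.\<close>
  also have "ln (exp 1 * L) = 1 + ln L"
    using \<open>1 \<le> L\<close> by (simp add: ln_mult)
  finally show "(CLINT w|\<Omega>. iexp (\<Sum>j\<in>J. q j * (X \<delta> w + W j w))) = (CLINT w|\<Omega>'. iexp (\<Sum>j\<in>J. q j * (W\<^sub>1 j w + W\<^sub>2 j w)))"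
    unfolding lhs by (simp add: algebra_simps flip: exp_add)
qed (fact \<open>prob_space \<Omega>\<close> \<open>prob_space \<Omega>'\<close>)+

end
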